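(* Let $m$ be odd and let $x^d$ be a maximum nonlinear power function on $\mathbb{F}_{2^m}$. Let $D_d=\{x\in\mathbb{F}_{2^m} : tr(x^d)=1\}$ and, for $\alpha,\beta\in\mathbb{F}_{2^m}$ and $i,j\in\mathbb{F}_2$, let $$H^{i,j}(\alpha,\beta)=\{x\in\mathbb{F}_{2^m} : tr(\alpha x)=i,\ tr(\beta x)=j\}.$$ Then $d=2^k+1$ for some integer $k$ with $\gcd(k,m)=1$ (i.e. $d$ is a Gold exponent) if and only if $$|H^{i,j}(\alpha,\beta)\cap D_d|\in\{2^{m-3},\ 2^{m-3}\pm 2^{\frac{m-3}{2}}\}$$ for all $\alpha,\beta\in\mathbb{F}_{2^m}\setminus\{0\}$ with $\alpha\neq\beta$ and all $i,j\in\mathbb{F}_2$.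
   Context: $\mathbb{F}_{2^m}$ is the finite field with $2^m$ elements, and $tr:\mathbb{F}_{2^m}\to\mathbb{F}_2$ is the trace map $tr(x)=\sum_{i=0}^{m-1}x^{2^i}$. The linearity of a function $F:\mathbb{F}_{2^m}\to\mathbb{F}_{2^m}$ is $$\mathcal{L}(F)=\max_{\beta,\gamma\in\mathbb{F}_{2^m},\ \beta\neq 0}\left|\sum_{x\in\mathbb{F}_{2^m}}(-1)^{tr(\gamma x+\beta F(x))}\right|.$$ $F$ is called maximum nonlinear (or almost bent) if $\mathcal{L}(F)=2^{\frac{m+1}{2}}$.
   Formalization: "d = 2^k+1" is replaced by d ≡ 2^s(2^k+1) mod 2^m−1 for some s and some k with gcd(k,m)=1, since the literal claim fails: for m=5, d=6 one has D_6=D_3, so the condition holds, but 6 is not 2^k+1, even mod 31. *)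

theory Defs
  imports "HOL-Number_Theory.Residues" "HOL-Library.Cardinality" Complex_Main
begin

text \<open>
  The field with \<open>2\<^sup>m\<close> elements is a type \<open>'a :: finite_field\<close> with \<open>CARD('a) = 2 ^ m\<close>; by
  \<open>finite_fieldI\<close> every finite field type is of this class. The prime field is the subset
  \<open>{0, 1}\<close> of \<open>'a\<close>, so the trace takes its values in \<open>'a\<close> itself (see \<open>abs_trace_in_prime_field\<close>).
\<close>

definition abs_trace :: "nat \<Rightarrow> 'a::finite_field \<Rightarrow> 'a"
  where "abs_trace m x = (\<Sum>i<m. x ^ (2 ^ i))"

lemma abs_trace_in_prime_field:
  fixes x :: "'a::finite_field"
  assumes card: "CARD('a) = 2 ^ m"
  shows "abs_trace m x \<in> {0, 1}"
proof -
  have "CHAR('a) dvd 2 ^ m"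
    using CHAR_dvd_CARD[where 'a = 'a] card by simp
  moreover have p: "prime CHAR('a)"
    by (rule prime_CHAR_semidom) simp
  ultimately have char: "CHAR('a) = 2"
    by (metis prime_dvd_power primes_dvd_imp_eq two_is_prime_nat)
  have "(abs_trace m x) ^ 2 = (\<Sum>i<m. (x ^ (2 ^ i)) ^ 2)"
    unfolding abs_trace_def using freshmans_dream_sum[OF p, of 2] char by auto
  also have "\<dots> = (\<Sum>i<m. x ^ (2 ^ Suc i))"
    by (simp add: power_mult[symmetric] mult.commute)
  also have "\<dots> = abs_trace m x"
    using sum.lessThan_Suc_shift[of "\<lambda>i. x ^ (2 ^ i)" m]
      sum.lessThan_Suc[of "\<lambda>i. x ^ (2 ^ i)" m]
      finite_field_power_card_eq_same[of x] card
    by (simp add: abs_trace_def add.commute)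
  finally have "abs_trace m x * (abs_trace m x - 1) = 0"
    by (simp add: power2_eq_square algebra_simps)
  then show ?thesis by simp
qed

text \<open>\<open>(-1)\<^sup>t\<close> for \<open>t\<close> in the prime field \<open>{0, 1}\<close>\<close>

definition neg_one_pow :: "'a::finite_field \<Rightarrow> int"
  where "neg_one_pow t = (if t = 0 then 1 else -1)"

definition linearity :: "nat \<Rightarrow> ('a::finite_field \<Rightarrow> 'a) \<Rightarrow> int"
  where "linearity m F =
    Max {\<bar>\<Sum>x\<in>UNIV. neg_one_pow (abs_trace m (\<gamma> * x + \<beta> * F x))\<bar> | \<beta> \<gamma>. \<beta> \<noteq> 0}"

definition maximum_nonlinear :: "nat \<Rightarrow> ('a::finite_field \<Rightarrow> 'a) \<Rightarrow> bool"
  where "maximum_nonlinear m F \<longleftrightarrow> real_of_int (linearity m F) = 2 powr ((real m + 1) / 2)"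

definition trace_one_set :: "nat \<Rightarrow> nat \<Rightarrow> 'a::finite_field set"
  where "trace_one_set m d = {x. abs_trace m (x ^ d) = 1}"

definition H_set :: "nat \<Rightarrow> 'a \<Rightarrow> 'a \<Rightarrow> 'a \<Rightarrow> 'a \<Rightarrow> 'a::finite_field set"
  where "H_set m i j \<alpha> \<beta> = {x. abs_trace m (\<alpha> * x) = i \<and> abs_trace m (\<beta> * x) = j}"

text \<open>
  Gold exponents are understood up to cyclotomic equivalence: \<open>d\<close> only matters modulo \<open>2\<^sup>m - 1\<close>,
  and replacing \<open>d\<close> by \<open>2\<^sup>s d\<close> does not change \<open>tr(x\<^sup>d)\<close>. For instance \<open>d = 6\<close> and \<open>d = 3\<close> define
  the same set \<open>{x. tr(x\<^sup>d) = 1}\<close>, although for \<open>m = 5\<close> the number \<open>6\<close> is not congruent to any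
  \<open>2\<^sup>k + 1\<close> modulo \<open>31\<close>. Negative \<open>k\<close> would add nothing, as \<open>2\<^sup>k\<close> modulo \<open>2\<^sup>m - 1\<close> depends only on
  \<open>k\<close> modulo \<open>m\<close>.
\<close>

definition gold_exponent :: "nat \<Rightarrow> nat \<Rightarrow> bool"
  where "gold_exponent m d \<longleftrightarrow>
    (\<exists>k s. coprime k m \<and> [d = 2 ^ s * (2 ^ k + 1)] (mod (2 ^ m - 1)))"

end

theory Submission
  imports Defs "HOL-Computational_Algebra.Polynomial" "HOL-Library.Nat_Bijection"
begin

text \<open>
  Write \<open>W\<close> for the Walsh transform of \<open>tr (x ^ d)\<close>. Comparing second and fourth moments, maximum
  nonlinearity forces \<open>W a\<close> to be \<open>0\<close> or \<open>\<plusminus>2 ^ ((m + 1) / 2)\<close> and \<open>x ^ d\<close> to be almost perfect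
  nonlinear, hence a permutation. Expanding the indicator functions, the condition on the intersection
  sizes says that an even number of \<open>W \<alpha>\<close>, \<open>W \<beta>\<close>, \<open>W (\<alpha> + \<beta>)\<close> is nonzero, that is, that the
  zeros of \<open>W\<close> form a subgroup of index \<open>2\<close>. For Gold exponents, \<open>(W a)\<^sup>2 = 2 ^ m * (1 - \<chi> a)\<close>.

  Conversely, the subgroup is stable under the Frobenius map, hence it is the kernel of the
  trace, and Fourier inversion gives \<open>tr (x ^ d + (x + 1) ^ d) = 1\<close> for all \<open>x\<close>. Let \<open>D\<close> be the set
  of binary digits of \<open>d\<close>, a subset of the integers modulo \<open>m\<close>. Comparing coefficients, every
  nonempty set with fewer than \<open>card D\<close> elements lies in an even number of cyclic shifts of \<open>D\<close>.
  A doubling argument applied to the shifts containing \<open>0\<close> yields \<open>2 ^ (card D - 1) \<le> card D\<close>, so \<open>d\<close>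
  has at most two binary digits.
\<close>

section \<open>Set families that cover small sets evenly\<close>

text \<open>Induction on \<open>r\<close>: choose a point \<open>p\<close> lying in some but not all
  members. The members through \<open>p\<close> inherit the hypothesis for sets smaller by one,
  because \<open>p\<close> can be added to \<open>S\<close>; the members avoiding \<open>p\<close>
  then inherit it by subtraction. Both halves are nonempty, so each step doubles the bound.\<close>

lemma card_ge_two_power_if_covers_even:
  fixes \<F> :: "'b set set"
  assumes "finite \<F>" "\<F> \<noteq> {}"
    and "\<And>S. finite S \<Longrightarrow> card S \<le> r \<Longrightarrow> even (card {A \<in> \<F>. S \<subseteq> A})"
  shows "2 ^ Suc r \<le> card \<F>"
  using assms
proof (induction r arbitrary: \<F>)
  case 0
  have "even (card \<F>)" using "0.prems"(3)[of "{}"] by simp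
  moreover have "card \<F> \<noteq> 0" using 0 by simp
  ultimately show ?case by (auto elim!: evenE)
next
  case (Suc r)
  have "even (card \<F>)" using Suc.prems(3)[of "{}"] by simp
  then have "\<not> card \<F> \<le> 1" using Suc.prems(1,2) by (auto simp: le_Suc_eq)
  then obtain A B where AB: "A \<in> \<F>" "B \<in> \<F>" "A \<noteq> B"
    using Suc.prems(1) by (auto simp: card_le_Suc0_iff_eq)
  have "\<exists>p A B. A \<in> \<F> \<and> B \<in> \<F> \<and> p \<in> A \<and> p \<notin> B"
  proof (cases "A \<subseteq> B")
    case True
    then show ?thesis using AB by (metis psubsetI psubset_imp_ex_mem DiffE)
  next
    case False
    then show ?thesis using AB by blast
  qed
  then obtain p where p: "\<exists>A\<in>\<F>. p \<in> A" "\<exists>A\<in>\<F>. p \<notin> A" by blast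
  define \<F>1 where "\<F>1 = {A \<in> \<F>. p \<in> A}"
  define \<F>0 where "\<F>0 = {A \<in> \<F>. p \<notin> A}"
  have fin: "finite \<F>1" "finite \<F>0" using Suc.prems(1) by (simp_all add: \<F>1_def \<F>0_def)
  have ne: "\<F>1 \<noteq> {}" "\<F>0 \<noteq> {}" using p by (auto simp: \<F>1_def \<F>0_def)
  have even1: "even (card {A \<in> \<F>1. S \<subseteq> A})" if "finite S" "card S \<le> r" for S
  proof -
    have "{A \<in> \<F>1. S \<subseteq> A} = {A \<in> \<F>. insert p S \<subseteq> A}" by (auto simp: \<F>1_def)
    moreover have "card (insert p S) \<le> Suc r" using that by (simp add: card_insert_if)
    ultimately show ?thesis using Suc.prems(3)[of "insert p S"] that by simp
  qed
  have even0: "even (card {A \<in> \<F>0. S \<subseteq> A})" if "finite S" "card S \<le> r" for S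
  proof -
    have "{A \<in> \<F>. S \<subseteq> A} = {A \<in> \<F>1. S \<subseteq> A} \<union> {A \<in> \<F>0. S \<subseteq> A}"
      by (auto simp: \<F>1_def \<F>0_def)
    moreover have "{A \<in> \<F>1. S \<subseteq> A} \<inter> {A \<in> \<F>0. S \<subseteq> A} = {}"
      by (auto simp: \<F>1_def \<F>0_def)
    ultimately have "card {A \<in> \<F>. S \<subseteq> A} = card {A \<in> \<F>1. S \<subseteq> A} + card {A \<in> \<F>0. S \<subseteq> A}"
      using fin by (simp add: card_Un_disjoint)
    then show ?thesis using Suc.prems(3)[of S] even1[OF that] that by simp
  qed
  have "\<F> = \<F>1 \<union> \<F>0" "\<F>1 \<inter> \<F>0 = {}" by (auto simp: \<F>1_def \<F>0_def)
  then have "card \<F> = card \<F>1 + card \<F>0" using fin by (simp add: card_Un_disjoint)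
  moreover have "2 ^ Suc r \<le> card \<F>1" "2 ^ Suc r \<le> card \<F>0"
    using Suc.IH[OF fin(1) ne(1) even1] Suc.IH[OF fin(2) ne(2) even0] by blast+
  ultimately show ?case by simp
qed

subsection \<open>Traces and characters\<close>

text \<open>The \<open>itself\<close> argument only carries the field type. Oddness of
  \<open>m\<close> gives \<open>tr 1 = 1\<close>, excludes primitive cube roots of unity, and makes
  \<open>2 * k\<close> coprime to \<open>m\<close> whenever \<open>k\<close> is.\<close>

locale odd_binary_field =
  fixes ty :: "'a::finite_field itself" and m :: nat
  assumes card_field: "CARD('a) = 2 ^ m" and odd_m: "odd m"
begin

abbreviation tr :: "'a \<Rightarrow> 'a" where "tr \<equiv> abs_trace m"

definition \<chi> :: "'a \<Rightarrow> int" where "\<chi> x = neg_one_pow (tr x)"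

lemma m_pos: "m > 0"
  using odd_m by (rule odd_pos)

lemma char_two: "CHAR('a) = 2"
proof -
  have "CHAR('a) dvd 2 ^ m"
    using CHAR_dvd_CARD[where 'a = 'a] card_field by simp
  moreover have "prime CHAR('a)"
    by (rule prime_CHAR_semidom) simp
  ultimately show ?thesis
    by (metis prime_dvd_power primes_dvd_imp_eq two_is_prime_nat)
qed

lemma add_self [simp]: "x + x = (0::'a)"
proof -
  have "(2::'a) = 0"
    using of_nat_CHAR[where 'a = 'a] by (simp add: char_two)
  then show ?thesis by (simp flip: mult_2)
qed

lemma two_eq_0 [simp]: "(2::'a) = 0"
  using add_self[of 1] by (simp only: one_add_one)

lemma add_self_left [simp]: "x + (x + y) = (y::'a)"
  by (simp flip: add.assoc)

lemma uminus_eq [simp]: "- x = (x::'a)"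
  using add_self[of x] by (simp add: minus_unique)

lemma add_eq_0_iff_eq [simp]: "x + y = 0 \<longleftrightarrow> x = (y::'a)"
  by (simp add: add_eq_0_iff2)

lemma frobenius_add: "(x + y :: 'a) ^ 2 ^ k = x ^ 2 ^ k + y ^ 2 ^ k"
  by (rule freshmans_dream'[OF CHAR_prime]) (simp add: char_two)

lemma square_add: "(x + y :: 'a)\<^sup>2 = x\<^sup>2 + y\<^sup>2"
  using frobenius_add[of x y 1] by simp

lemma power_field_card [simp]: "(x::'a) ^ 2 ^ m = x"
  using finite_field_power_card_eq_same[of x] card_field by simp

lemma frobenius_periodic: "(x::'a) ^ 2 ^ (i + m) = x ^ 2 ^ i"
  by (simp add: power_add power_mult)

lemma frobenius_mod: "(x::'a) ^ 2 ^ (i mod m) = x ^ 2 ^ i"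
proof -
  have "x ^ 2 ^ (j + m * t) = x ^ 2 ^ j" for j t
  proof (induction t)
    case (Suc t)
    then show ?case using frobenius_periodic[of x "j + m * t"] by (simp add: ac_simps)
  qed simp
  from this[of "i mod m" "i div m"] show ?thesis by simp
qed

lemma frobenius_inj: "(x::'a) ^ 2 ^ k = y ^ 2 ^ k \<longleftrightarrow> x = y"
proof
  assume "x ^ 2 ^ k = y ^ 2 ^ k"
  then have "(x + y) ^ 2 ^ k = 0" by (simp add: frobenius_add)
  then show "x = y" by simp
qed simp

lemma frobenius_bij: "bij (\<lambda>x::'a. x ^ 2 ^ k)"
  by (simp add: bij_def finite_UNIV_inj_surj frobenius_inj inj_on_def)

lemma trace_prime_field: "tr x = 0 \<or> tr x = 1"
  using abs_trace_in_prime_field[OF card_field, of x] by simp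

lemma trace_add: "tr (x + y) = tr x + tr y"
  by (simp add: abs_trace_def frobenius_add sum.distrib)

lemma trace_0 [simp]: "tr 0 = 0"
  by (simp add: abs_trace_def power_0_left)

lemma trace_sum: "tr (sum f A) = (\<Sum>x\<in>A. tr (f x))"
  by (induction A rule: infinite_finite_induct) (simp_all add: trace_add)

lemma trace_1: "tr 1 = 1"
proof -
  have "tr 1 = of_nat m" by (simp add: abs_trace_def)
  also have "\<dots> = 1"
    using odd_m by (elim oddE) (simp flip: mult_2[symmetric])
  finally show ?thesis .
qed

lemma trace_square: "tr (x\<^sup>2) = tr x"
proof -
  have "tr (x\<^sup>2) = (\<Sum>i<m. x ^ 2 ^ Suc i)"
    by (simp add: abs_trace_def flip: power_mult)
  also have "\<dots> = tr x"
    using sum.lessThan_Suc_shift[of "\<lambda>i. x ^ 2 ^ i" m] sum.lessThan_Suc[of "\<lambda>i. x ^ 2 ^ i" m]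
    by (simp add: abs_trace_def add.commute)
  finally show ?thesis .
qed

lemma trace_frobenius: "tr (x ^ 2 ^ k) = tr x"
  by (induction k) (simp_all add: trace_square power_mult mult.commute[of 2])

lemma chi_cases: "\<chi> x = 1 \<or> \<chi> x = -1"
  by (simp add: \<chi>_def neg_one_pow_def)

lemma chi_square [simp]: "\<chi> x * \<chi> x = 1"
  using chi_cases[of x] by auto

lemma chi_add: "\<chi> (x + y) = \<chi> x * \<chi> y"
  using trace_prime_field[of x] trace_prime_field[of y]
  by (auto simp: \<chi>_def neg_one_pow_def trace_add)

lemma chi_0 [simp]: "\<chi> 0 = 1"
  by (simp add: \<chi>_def neg_one_pow_def)

lemma chi_1 [simp]: "\<chi> 1 = -1"
  by (simp add: \<chi>_def neg_one_pow_def trace_1)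

lemma chi_frobenius: "\<chi> (x ^ 2 ^ k) = \<chi> x"
  by (simp add: \<chi>_def trace_frobenius)

lemma trace_eq_1_iff: "tr x = 1 \<longleftrightarrow> \<chi> x = -1"
  using trace_prime_field[of x] by (auto simp: \<chi>_def neg_one_pow_def)

lemma sum_shift: "(\<Sum>x\<in>UNIV. f (x + u)) = (\<Sum>x\<in>UNIV. f (x::'a))"
  by (rule sum.reindex_bij_witness[of _ "\<lambda>x. x + u" "\<lambda>x. x + u"]) (simp_all add: add.assoc)

lemma sum_additive_character:
  fixes \<psi> :: "'a \<Rightarrow> int"
  assumes "\<And>x y. \<psi> (x + y) = \<psi> x * \<psi> y" and "\<psi> v \<noteq> 1"
  shows "(\<Sum>x\<in>UNIV. \<psi> x) = 0"
proof -
  have "(\<Sum>x\<in>UNIV. \<psi> x) = (\<Sum>x\<in>UNIV. \<psi> (x + v))"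
    by (simp only: sum_shift)
  also have "\<dots> = \<psi> v * (\<Sum>x\<in>UNIV. \<psi> x)"
    by (simp add: assms(1) sum_distrib_left mult.commute)
  finally show ?thesis using assms(2) by simp
qed

lemma sum_chi_mult: "(\<Sum>x\<in>UNIV. \<chi> (a * x)) = (if a = 0 then 2 ^ m else 0)"
proof (cases "a = 0")
  case True
  then show ?thesis using card_field by simp
next
  case False
  have "(\<Sum>x\<in>UNIV. \<chi> (a * x)) = 0"
    by (rule sum_additive_character[where v = "1 / a"])
      (simp_all add: distrib_left chi_add False)
  then show ?thesis using False by simp
qed

lemma sum_chi_mult': "(\<Sum>x\<in>UNIV. \<chi> (x * a)) = (if a = 0 then 2 ^ m else 0)"
  using sum_chi_mult[of a] by (simp add: mult.commute)

subsection \<open>Fourier transform\<close>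

definition ft :: "('a \<Rightarrow> int) \<Rightarrow> 'a \<Rightarrow> int"
  where "ft g a = (\<Sum>x\<in>UNIV. g x * \<chi> (a * x))"

definition autocorrelation :: "('a \<Rightarrow> int) \<Rightarrow> 'a \<Rightarrow> int"
  where "autocorrelation g u = (\<Sum>x\<in>UNIV. g x * g (x + u))"

lemma ft_inversion: "(\<Sum>a\<in>UNIV. ft g a * \<chi> (a * v)) = 2 ^ m * g v"
proof -
  have "(\<Sum>a\<in>UNIV. ft g a * \<chi> (a * v)) = (\<Sum>a\<in>UNIV. \<Sum>x\<in>UNIV. g x * \<chi> (a * (x + v)))"
    by (simp add: ft_def sum_distrib_right distrib_left chi_add mult.assoc)
  also have "\<dots> = (\<Sum>x\<in>UNIV. g x * (\<Sum>a\<in>UNIV. \<chi> (a * (x + v))))"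
    by (subst sum.swap) (simp add: sum_distrib_left)
  also have "\<dots> = (\<Sum>x\<in>UNIV. if x = v then 2 ^ m * g v else 0)"
    unfolding sum_chi_mult' by (intro sum.cong) auto
  finally show ?thesis by simp
qed

lemma parseval: "(\<Sum>a\<in>UNIV. (ft g a)\<^sup>2) = 2 ^ m * (\<Sum>x\<in>UNIV. (g x)\<^sup>2)"
proof -
  have "(\<Sum>a\<in>UNIV. (ft g a)\<^sup>2) = (\<Sum>a\<in>UNIV. \<Sum>x\<in>UNIV. g x * (ft g a * \<chi> (a * x)))"
    unfolding power2_eq_square
    by (subst (2) ft_def) (simp add: sum_distrib_left ac_simps)
  also have "\<dots> = (\<Sum>x\<in>UNIV. g x * (\<Sum>a\<in>UNIV. ft g a * \<chi> (a * x)))"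
    by (subst sum.swap) (simp add: sum_distrib_left)
  also have "\<dots> = 2 ^ m * (\<Sum>x\<in>UNIV. (g x)\<^sup>2)"
    unfolding ft_inversion by (simp add: sum_distrib_left power2_eq_square ac_simps)
  finally show ?thesis .
qed

text \<open>Wiener-Khinchin: after the substitution \<open>y = u + x\<close> in the double sum, the
  factors \<open>\<chi> (a * x)\<close> cancel and only \<open>\<chi> (a * u)\<close>
  remains.\<close>

lemma ft_square: "(ft g a)\<^sup>2 = ft (autocorrelation g) a"
proof -
  have "(ft g a)\<^sup>2 = (\<Sum>x\<in>UNIV. \<Sum>y\<in>UNIV. (g x * \<chi> (a * x)) * (g y * \<chi> (a * y)))"
    by (simp add: ft_def power2_eq_square sum_product)
  also have "\<dots> = (\<Sum>x\<in>UNIV. \<Sum>u\<in>UNIV. (g x * \<chi> (a * x)) * (g (u + x) * \<chi> (a * (u + x))))"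
    by (intro sum.cong refl sum_shift[symmetric])
  also have "\<dots> = (\<Sum>x\<in>UNIV. \<Sum>u\<in>UNIV. g x * g (x + u) * \<chi> (a * u) * (\<chi> (a * x) * \<chi> (a * x)))"
    by (simp only: distrib_left chi_add ac_simps)
  also have "\<dots> = (\<Sum>u\<in>UNIV. (\<Sum>x\<in>UNIV. g x * g (x + u)) * \<chi> (a * u))"
    by (subst sum.swap) (simp add: sum_distrib_right)
  finally show ?thesis by (simp add: ft_def autocorrelation_def)
qed

subsection \<open>Maximum nonlinear functions\<close>

text \<open>The sign form of the component function \<open>tr (\<beta> * F x)\<close>; its transform
  at \<open>\<gamma>\<close> is the character sum that occurs in the linearity.\<close>

definition component :: "('a \<Rightarrow> 'a) \<Rightarrow> 'a \<Rightarrow> 'a \<Rightarrow> int"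
  where "component F \<beta> x = \<chi> (\<beta> * F x)"

text \<open>Almost perfect nonlinearity of \<open>F\<close> means that for
  \<open>u \<noteq> 0\<close> only the trivial pairs \<open>y = x\<close> and
  \<open>y = x + u\<close> occur here.\<close>

definition derivative_collisions :: "('a \<Rightarrow> 'a) \<Rightarrow> 'a \<Rightarrow> ('a \<times> 'a) set"
  where "derivative_collisions F u = {(x, y). F x + F (x + u) = F y + F (y + u)}"

lemma sum_square_chi:
  "(\<Sum>\<beta>\<in>UNIV. (\<Sum>x\<in>UNIV. \<chi> (\<beta> * D x))\<^sup>2) = 2 ^ m * int (card {(x, y). D x = D (y :: 'a)})"
proof -
  have "(\<Sum>\<beta>\<in>UNIV. (\<Sum>x\<in>UNIV. \<chi> (\<beta> * D x))\<^sup>2)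
      = (\<Sum>\<beta>\<in>UNIV. \<Sum>(x, y)\<in>UNIV. \<chi> (\<beta> * (D x + D y)))"
    by (simp add: power2_eq_square sum_product sum.cartesian_product distrib_left chi_add)
  also have "\<dots> = (\<Sum>(x, y)\<in>UNIV. \<Sum>\<beta>\<in>UNIV. \<chi> (\<beta> * (D x + D y)))"
    by (subst sum.swap) (simp add: case_prod_unfold)
  also have "\<dots> = (\<Sum>p\<in>UNIV. if p \<in> {(x, y). D x = D y} then 2 ^ m else 0)"
    unfolding sum_chi_mult' by (intro sum.cong) auto
  also have "\<dots> = 2 ^ m * int (card {(x, y). D x = D y})"
    by (subst sum.inter_restrict[symmetric]) simp_all
  finally show ?thesis .
qed

text \<open>The fourth power is the squared transform of the autocorrelation, so Parseval applies in
  \<open>\<gamma>\<close>. The sum over \<open>\<beta>\<close> then counts collisions by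
  orthogonality of characters.\<close>

lemma fourth_moment:
  "(\<Sum>\<beta>\<in>UNIV. \<Sum>\<gamma>\<in>UNIV. (ft (component F \<beta>) \<gamma>) ^ 4)
    = 2 ^ m * 2 ^ m * (\<Sum>u\<in>UNIV. int (card (derivative_collisions F u)))"
proof -
  have "(\<Sum>\<gamma>\<in>UNIV. (ft (component F \<beta>) \<gamma>) ^ 4)
      = 2 ^ m * (\<Sum>u\<in>UNIV. (\<Sum>x\<in>UNIV. \<chi> (\<beta> * (F x + F (x + u))))\<^sup>2)" for \<beta>
  proof -
    have "(\<Sum>\<gamma>\<in>UNIV. (ft (component F \<beta>) \<gamma>) ^ 4)
        = (\<Sum>\<gamma>\<in>UNIV. (ft (autocorrelation (component F \<beta>)) \<gamma>)\<^sup>2)"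
      by (simp flip: ft_square)
    then show ?thesis
      by (simp add: parseval autocorrelation_def component_def distrib_left chi_add)
  qed
  then have "(\<Sum>\<beta>\<in>UNIV. \<Sum>\<gamma>\<in>UNIV. (ft (component F \<beta>) \<gamma>) ^ 4)
      = 2 ^ m * (\<Sum>u\<in>UNIV. \<Sum>\<beta>\<in>UNIV. (\<Sum>x\<in>UNIV. \<chi> (\<beta> * (F x + F (x + u))))\<^sup>2)"
    by (subst sum.swap) (simp add: sum_distrib_left)
  then show ?thesis
    by (simp add: sum_square_chi derivative_collisions_def sum_distrib_left mult.assoc)
qed

lemma trivial_collisions: "{(x, y). y = x \<or> y = x + u} \<subseteq> derivative_collisions F u"
  by (auto simp: derivative_collisions_def add.assoc add.commute)

lemma card_trivial_collisions:
  assumes "u \<noteq> 0"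
  shows "card {(x, y). y = x \<or> y = x + (u::'a)} = 2 * 2 ^ m"
proof -
  have "{(x, y). y = x \<or> y = x + u} = (SIGMA x:UNIV. {x, x + u})" by auto
  moreover have "card \<dots> = (\<Sum>x\<in>UNIV. card {x, x + u})" by (rule card_SigmaI) auto
  moreover have "card {x, x + u} = 2" for x using assms by simp
  ultimately show ?thesis using card_field by simp
qed

lemma ft_bound:
  assumes "\<beta> \<noteq> 0"
  shows "\<bar>ft (component F \<beta>) \<gamma>\<bar> \<le> linearity m F"
  unfolding linearity_def
proof (rule Max_ge)
  have "ft (component F \<beta>) \<gamma> = (\<Sum>x\<in>UNIV. neg_one_pow (tr (\<gamma> * x + \<beta> * F x)))"
    by (simp add: ft_def component_def chi_add mult.commute flip: \<chi>_def)
  then show "\<bar>ft (component F \<beta>) \<gamma>\<bar> \<in>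
      {\<bar>\<Sum>x\<in>UNIV. neg_one_pow (tr (\<gamma> * x + \<beta> * F x))\<bar> | \<beta> \<gamma>. \<beta> \<noteq> 0}"
    using assms by auto
qed (rule finite_subset[of _ "(\<lambda>(\<beta>, \<gamma>). \<bar>\<Sum>x\<in>UNIV. neg_one_pow (tr (\<gamma> * x + \<beta> * F x))\<bar>) ` UNIV"], auto)

lemma linearity_square:
  assumes "maximum_nonlinear m F"
  shows "(linearity m F)\<^sup>2 = 2 * 2 ^ m"
proof -
  have "real_of_int ((linearity m F)\<^sup>2) = (2 powr ((real m + 1) / 2))\<^sup>2"
    using assms by (simp add: maximum_nonlinear_def)
  also have "\<dots> = 2 powr (real (m + 1))"
    by (simp add: power2_eq_square add.commute flip: powr_add)
  also have "\<dots> = 2 ^ (m + 1)"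
    by (rule powr_realpow) simp
  also have "\<dots> = real_of_int (2 * 2 ^ m)" by simp
  finally show ?thesis by linarith
qed

text \<open>
  Parseval and the trivial collisions \<open>y \<in> {x, x + u}\<close> bound the fourth moment from both sides
  by the same number, so the inequalities used are all equalities.
\<close>
lemma maximum_nonlinear_extremal:
  assumes "maximum_nonlinear m F"
  shows maximum_nonlinear_ft_square: "\<beta> \<noteq> 0 \<Longrightarrow> (ft (component F \<beta>) \<gamma>)\<^sup>2 \<in> {0, 2 * 2 ^ m}"
    and maximum_nonlinear_collisions:
      "u \<noteq> 0 \<Longrightarrow> derivative_collisions F u = {(x, y). y = x \<or> y = x + u}"
proof -
  define q :: int where "q = 2 ^ m"
  define w where "w \<beta> \<gamma> = (ft (component F \<beta>) \<gamma>)\<^sup>2" for \<beta> \<gamma>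
  define n where "n u = int (card (derivative_collisions F u))" for u
  have card_units: "int (card (UNIV - {0::'a})) = q - 1"
    using card_field by (simp add: q_def of_nat_diff)
  have w_le: "w \<beta> \<gamma> \<le> 2 * q" if "\<beta> \<noteq> 0" for \<beta> \<gamma>
    using power_mono[OF ft_bound[OF that, of F \<gamma>], of 2] linearity_square[OF assms]
    by (simp add: w_def q_def)
  have w_sum: "(\<Sum>\<gamma>\<in>UNIV. w \<beta> \<gamma>) = q * q" for \<beta>
    unfolding w_def parseval using card_field
    by (simp add: component_def power2_eq_square q_def)
  \<comment> \<open>The trivial component is constant: its transform is \<open>q\<close> at
    \<open>0\<close> and vanishes elsewhere, so its share of the fourth moment is
    \<open>q ^ 4\<close>.\<close>
  have "component F 0 = (\<lambda>x. 1)" by (simp add: component_def fun_eq_iff)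
  then have "(w 0 \<gamma>)\<^sup>2 = (if \<gamma> = 0 then q ^ 4 else 0)" for \<gamma>
    by (simp add: w_def ft_def sum_chi_mult q_def)
  then have w0_sum: "(\<Sum>\<gamma>\<in>UNIV. (w 0 \<gamma>)\<^sup>2) = q ^ 4" by simp
  have "w \<beta> \<gamma> ^ 2 = ft (component F \<beta>) \<gamma> ^ 4" for \<beta> \<gamma>
    by (simp add: w_def)
  then have moment: "(\<Sum>\<beta>\<in>UNIV. \<Sum>\<gamma>\<in>UNIV. (w \<beta> \<gamma>)\<^sup>2) = q * q * (\<Sum>u\<in>UNIV. n u)"
    by (simp add: fourth_moment n_def q_def)
  have n_ge: "0 \<le> n u - 2 * q" if "u \<noteq> 0" for u
  proof -
    have "2 * 2 ^ m \<le> card (derivative_collisions F u)"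
      using card_mono[OF _ trivial_collisions[of u F]] card_trivial_collisions[OF that] by simp
    then have "int (2 * 2 ^ m) \<le> n u" unfolding n_def by (rule of_nat_mono)
    then show ?thesis by (simp add: q_def)
  qed
  have "derivative_collisions F 0 = UNIV" by (auto simp: derivative_collisions_def)
  then have n0: "n 0 = q * q"
    using card_field by (simp add: n_def q_def card_cartesian_product flip: UNIV_Times_UNIV)
  have split0: "(\<Sum>x\<in>UNIV. h x) = h 0 + (\<Sum>x\<in>UNIV - {0}. h x)" for h :: "'a \<Rightarrow> int"
    by (simp add: sum.remove[of UNIV 0])
  \<comment> \<open>\<open>A\<close> collects the slack in
    \<open>w \<beta> \<gamma> \<le> 2 * q\<close>, weighted by \<open>w \<beta> \<gamma>\<close>,
    and \<open>B\<close> the slack in the collision counts. In the moment identity all pure powers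
    of \<open>q\<close> cancel, leaving \<open>A + q * q * B = 0\<close> with both terms
    nonnegative.\<close>
  define A where "A = (\<Sum>\<beta>\<in>UNIV - {0}. \<Sum>\<gamma>\<in>UNIV. w \<beta> \<gamma> * (2 * q - w \<beta> \<gamma>))"
  define B where "B = (\<Sum>u\<in>UNIV - {0}. n u - 2 * q)"
  have "A = 2 * q * (\<Sum>\<beta>\<in>UNIV - {0}. \<Sum>\<gamma>\<in>UNIV. w \<beta> \<gamma>) - (\<Sum>\<beta>\<in>UNIV - {0}. \<Sum>\<gamma>\<in>UNIV. (w \<beta> \<gamma>)\<^sup>2)"
    by (simp add: A_def sum_distrib_left sum_subtractf algebra_simps power2_eq_square)
  also have "(\<Sum>\<beta>\<in>UNIV - {0}. \<Sum>\<gamma>\<in>UNIV. (w \<beta> \<gamma>)\<^sup>2) = q * q * (\<Sum>u\<in>UNIV. n u) - q ^ 4"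
    using moment split0[of "\<lambda>\<beta>. \<Sum>\<gamma>\<in>UNIV. (w \<beta> \<gamma>)\<^sup>2"] w0_sum by simp
  also have "(\<Sum>u\<in>UNIV. n u) = q * q + B + (q - 1) * (2 * q)"
    using split0[of n] n0 by (simp add: B_def sum_subtractf flip: card_units)
  also have "(\<Sum>\<beta>\<in>UNIV - {0}. \<Sum>\<gamma>\<in>UNIV. w \<beta> \<gamma>) = (q - 1) * (q * q)"
    by (simp add: w_sum flip: card_units)
  finally have AB: "A + q * q * B = 0"
    by (simp add: algebra_simps power4_eq_xxxx)
  have A_terms: "0 \<le> w \<beta> \<gamma> * (2 * q - w \<beta> \<gamma>)" if "\<beta> \<noteq> 0" for \<beta> \<gamma>
    using w_le[OF that, of \<gamma>] by (simp add: w_def)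
  then have A_nonneg: "0 \<le> A"
    unfolding A_def by (intro sum_nonneg) auto
  have B_nonneg: "0 \<le> B"
    unfolding B_def using n_ge by (intro sum_nonneg) auto
  have q_pos: "q > 0" by (simp add: q_def)
  then have "0 \<le> q * q * B" using B_nonneg by simp
  with AB A_nonneg have "A = 0" "q * q * B = 0" by linarith+
  then have "B = 0" using q_pos by simp
  show "(ft (component F \<beta>) \<gamma>)\<^sup>2 \<in> {0, 2 * 2 ^ m}" if "\<beta> \<noteq> 0"
  proof -
    have "(\<Sum>\<gamma>\<in>UNIV. w \<beta> \<gamma> * (2 * q - w \<beta> \<gamma>)) = 0"
      using \<open>A = 0\<close> that A_terms unfolding A_def
      by (subst (asm) sum_nonneg_eq_0_iff) (auto intro!: sum_nonneg)
    then have "w \<beta> \<gamma> * (2 * q - w \<beta> \<gamma>) = 0"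
      using A_terms[OF that] by (subst (asm) sum_nonneg_eq_0_iff) auto
    then show ?thesis by (auto simp: w_def q_def)
  qed
  show "derivative_collisions F u = {(x, y). y = x \<or> y = x + u}" if "u \<noteq> 0"
  proof -
    have "n u = 2 * q"
      using \<open>B = 0\<close> that n_ge unfolding B_def
      by (subst (asm) sum_nonneg_eq_0_iff) auto
    then have "card (derivative_collisions F u) = card {(x, y). y = x \<or> y = x + u}"
      unfolding card_trivial_collisions[OF that] n_def q_def
      by (simp only: flip: of_nat_eq_iff[where 'a = int]) simp
    then show ?thesis
      using card_subset_eq[OF _ trivial_collisions[of u F]] by simp
  qed
qed

lemma maximum_nonlinear_derivative:
  fixes F :: "'a \<Rightarrow> 'a"
  assumes "maximum_nonlinear m F" "u \<noteq> 0" "F x + F (x + u) = F y + F (y + u)"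
  shows "y = x \<or> y = x + u"
  using maximum_nonlinear_collisions[OF assms(1,2)] assms(3) by (auto simp: derivative_collisions_def)

section \<open>Maximum nonlinear power functions are permutations\<close>

text \<open>Such an element is fixed by \<open>x \<mapsto> x ^ 4\<close>. As \<open>m\<close> is
  odd, \<open>\<omega> = \<omega> ^ 2 ^ m\<close> then equals the square of \<open>\<omega>\<close>,
  which is \<open>\<omega> + 1\<close>.\<close>

lemma cube_root_of_unity:
  fixes \<omega> :: 'a
  assumes "\<omega>\<^sup>2 + \<omega> + 1 = 0"
  shows False
proof -
  have sq: "\<omega>\<^sup>2 = \<omega> + 1"
    using assms by (simp add: add.assoc)
  have fourth: "\<omega> ^ 2 ^ 2 = \<omega>"
    using square_add[of \<omega> 1] by (simp add: sq flip: power_mult[of \<omega> 2 2, simplified])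
  have "\<omega> ^ 2 ^ (2 * t) = \<omega>" for t
    by (induction t) (use fourth in \<open>simp_all add: power_add power_mult\<close>)
  then obtain t where "m = 2 * t + 1" "\<omega> ^ 2 ^ (2 * t) = \<omega>"
    using odd_m by (auto elim: oddE)
  then have "\<omega>\<^sup>2 = \<omega>"
    using power_field_card[of \<omega>] power_mult[of \<omega> "2 ^ (2 * t)" 2] by (simp add: mult.commute)
  then show False using sq by simp
qed

text \<open>For \<open>\<omega> \<noteq> 1\<close> the choice of \<open>x\<close> makes
  \<open>(x + 1) / x = \<omega>\<close>, so the derivative in direction \<open>1\<close> vanishes at
  \<open>x\<close>, and also at its square. Almost perfect nonlinearity allows only two positions
  for the square: one forces \<open>\<omega> = 0\<close>, the other makes \<open>x\<close> a
  primitive cube root of unity.\<close>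

lemma maximum_nonlinear_power_root:
  fixes \<omega> :: 'a
  assumes mn: "maximum_nonlinear m (\<lambda>x::'a. x ^ d)" and "\<omega> ^ d = 1" "\<omega> \<noteq> 0"
  shows "\<omega> = 1"
proof (rule ccontr)
  assume "\<omega> \<noteq> 1"
  then have nz: "\<omega> + 1 \<noteq> 0" by simp
  define x where "x = 1 / (\<omega> + 1)"
  have x1: "x + 1 = \<omega> * x"
    using nz by (simp add: x_def field_simps)
  have x: "x ^ d + (x + 1) ^ d = 0"
    unfolding x1 by (simp add: power_mult_distrib assms)
  have y1: "x\<^sup>2 + 1 = \<omega>\<^sup>2 * x\<^sup>2"
    using square_add[of x 1] by (simp add: x1 power_mult_distrib)
  have y: "(x\<^sup>2) ^ d + (x\<^sup>2 + 1) ^ d = 0"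
    unfolding y1 using assms(2)
    by (simp add: power_mult_distrib flip: power_mult) (simp add: mult.commute[of 2] power_mult assms)
  have "x\<^sup>2 = x \<or> x\<^sup>2 = x + 1"
    using maximum_nonlinear_derivative[OF mn, of 1 x "x\<^sup>2"] x y by simp
  then show False
  proof
    assume "x\<^sup>2 = x"
    then have "x = 1" using nz by (simp add: x_def power2_eq_square)
    then show False using x1 assms(3) by simp
  next
    assume "x\<^sup>2 = x + 1"
    then show False using cube_root_of_unity[of x] by (simp add: add.assoc)
  qed
qed

text \<open>Quotients of elements with equal \<open>d\<close>-th powers are \<open>d\<close>-th
  roots of unity. The case \<open>m = 1\<close> is excluded because there \<open>d = 0\<close> also
  gives a maximum nonlinear function.\<close>

lemma maximum_nonlinear_power_bij:
  assumes mn: "maximum_nonlinear m (\<lambda>x::'a. x ^ d)" and "m \<noteq> 1"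
  shows "d > 0" and "bij (\<lambda>x::'a. x ^ d)"
proof -
  show d: "d > 0"
  proof (rule ccontr)
    assume "\<not> d > 0"
    then have "(UNIV :: 'a set) \<subseteq> {0, 1}"
      using maximum_nonlinear_power_root[OF mn] by auto
    then have "CARD('a) \<le> 2"
      using card_mono[of "{0, 1 :: 'a}" UNIV] by simp
    moreover have "(2::nat) ^ 2 \<le> 2 ^ m"
      using m_pos assms(2) by (intro power_increasing) auto
    ultimately show False using card_field by simp
  qed
  have "x = y" if "x ^ d = y ^ d" for x y :: 'a
  proof (cases "x = 0 \<or> y = 0")
    case True
    then show ?thesis using that d by (auto simp: power_0_left)
  next
    case False
    then show ?thesis
      using maximum_nonlinear_power_root[OF mn, of "x / y"] that by (simp add: power_divide)
  qed
  then show "bij (\<lambda>x::'a. x ^ d)"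
    by (simp add: bij_def finite_UNIV_inj_surj inj_on_def)
qed

subsection \<open>Power functions with constant trace derivative\<close>

lemma monomials_independent:
  fixes c :: "nat \<Rightarrow> 'a"
  assumes "\<And>x. (\<Sum>n<2 ^ m. c n * x ^ n) = 0" and "n < 2 ^ m"
  shows "c n = 0"
proof -
  define p where "p = (\<Sum>n<2 ^ m. monom (c n) n)"
  have "poly p x = 0" for x
    using assms(1) by (simp add: p_def poly_sum poly_monom)
  moreover have "degree p < 2 ^ m"
    unfolding p_def by (rule degree_sum_less) (auto intro: le_less_trans[OF degree_monom_le])
  ultimately have "p = 0"
    using card_poly_roots_bound[of p] card_field by fastforce
  moreover have "coeff p n = c n"
    using assms(2) by (simp add: p_def coeff_sum)
  ultimately show ?thesis by simp
qed

text \<open>Grouping equal exponents, the coefficient of \<open>x ^ n\<close> is the multiplicity of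
  \<open>n\<close>, read modulo \<open>2\<close>. This turns identities of functions into parity
  statements.\<close>

lemma sum_powers_eq_0_imp_even:
  assumes "finite I" "\<And>i. i \<in> I \<Longrightarrow> e i < 2 ^ m"
    and "\<And>x::'a. (\<Sum>i\<in>I. x ^ e i) = 0" "n < 2 ^ m"
  shows "even (card {i \<in> I. e i = n})"
proof -
  have "(\<Sum>n<2 ^ m. of_nat (card {i \<in> I. e i = n}) * x ^ n) = 0" for x :: 'a
  proof -
    have "(\<Sum>n<2 ^ m. of_nat (card {i \<in> I. e i = n}) * x ^ n) = (\<Sum>n<2 ^ m. \<Sum>i\<in>{i \<in> I. e i = n}. x ^ e i)"
      by simp
    also have "\<dots> = (\<Sum>i\<in>I. x ^ e i)"
      by (rule sum.group) (use assms(1,2) in auto)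
    finally show ?thesis using assms(3) by simp
  qed
  from monomials_independent[OF this assms(4)] show ?thesis
    by (simp add: of_nat_eq_0_iff_char_dvd char_two)
qed

lemma frobenius_powers_distinct:
  assumes "\<And>x::'a. x ^ 2 ^ i = x ^ 2 ^ j" "i < m" "j < m"
  shows "i = j"
proof (rule ccontr)
  assume "i \<noteq> j"
  then have "even (card {k \<in> {i, j}. (2::nat) ^ k = 2 ^ i})"
    using assms by (intro sum_powers_eq_0_imp_even) auto
  moreover have "{k \<in> {i, j}. (2::nat) ^ k = 2 ^ i} = {i}" by auto
  ultimately show False by simp
qed

section \<open>Binary digits of exponents and their cyclic shifts\<close>

text \<open>Exponents are represented by their sets of binary digits through
  \<open>set_encode\<close>. Raising to the power \<open>2 ^ i\<close> then rotates the digit set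
  modulo \<open>m\<close>.\<close>

definition shift :: "nat \<Rightarrow> nat set \<Rightarrow> nat set"
  where "shift i T = (\<lambda>j. (j + i) mod m) ` T"

lemma inj_on_shift: "inj_on (\<lambda>j. (j + i) mod m) {..<m}"
proof (rule inj_onI)
  fix j k assume "j \<in> {..<m}" "k \<in> {..<m}" "(j + i) mod m = (k + i) mod m"
  then show "j = k" using cong_add_rcancel_nat[of j i k m] by (simp add: cong_def)
qed

lemma shift_subset: "shift i T \<subseteq> {..<m}"
  using m_pos by (auto simp: shift_def)

lemma set_encode_less:
  assumes "T \<subseteq> {..<m}"
  shows "set_encode T < 2 ^ m"
proof -
  have "set_encode T \<le> set_encode {..<m}"
    unfolding set_encode_def using assms by (intro sum_mono2) auto
  also have "\<dots> < 2 ^ m"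
    by (simp add: set_encode_def lessThan_atLeast0 sum_power2)
  finally show ?thesis .
qed

lemma power_set_encode: "(x::'a) ^ set_encode T = (\<Prod>j\<in>T. x ^ 2 ^ j)"
  by (simp add: set_encode_def power_sum)

lemma power_set_encode_shift:
  assumes "T \<subseteq> {..<m}"
  shows "(x::'a) ^ set_encode (shift i T) = (x ^ set_encode T) ^ 2 ^ i"
proof -
  have "inj_on (\<lambda>j. (j + i) mod m) T"
    using inj_on_shift assms by (rule inj_on_subset)
  then show ?thesis
    by (simp add: power_set_encode shift_def prod.reindex frobenius_mod prod_power_distrib
        power_add power_mult)
qed

text \<open>The power is the product of the factors \<open>x ^ 2 ^ j + 1\<close> over the digits
  \<open>j\<close>; multiplying out selects a subset of \<open>D\<close>.\<close>

lemma power_set_encode_plus_1: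
  assumes "finite D"
  shows "(x + 1 :: 'a) ^ set_encode D = (\<Sum>E\<in>Pow D. x ^ set_encode E)"
  using assms by (simp add: power_set_encode frobenius_add prod_add)

text \<open>In the expansion of the derivative the subset \<open>D\<close> cancels, and the empty
  set accounts for the constant \<open>1\<close>. The remaining terms, with the trace written out,
  give a vanishing sum of powers, in which the exponent of \<open>T\<close> occurs once for each
  \<open>i\<close> such that \<open>T\<close> is a proper subset of
  \<open>shift i D\<close>.\<close>

lemma even_covering_shifts:
  assumes D: "D \<subseteq> {..<m}" "D \<noteq> {}"
    and f: "\<And>x. tr (x ^ set_encode D + (x + 1) ^ set_encode D) = 1"
    and T: "T \<noteq> {}"
  shows "even (card {i \<in> {..<m}. T \<subset> shift i D})"
proof (cases "T \<subseteq> {..<m}")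
  case False
  then have "{i \<in> {..<m}. T \<subset> shift i D} = {}" using shift_subset by blast
  then show ?thesis by (simp only: card.empty even_zero)
next
  case T': True
  define I where "I = (Pow D - {{}, D}) \<times> {..<m}"
  have finD: "finite D" using D(1) finite_subset by blast
  have zero: "(\<Sum>(E, i)\<in>I. x ^ set_encode (shift i E)) = 0" for x :: 'a
  proof -
    have "tr (x ^ set_encode D + (x + 1) ^ set_encode D)
        = tr (1 + (\<Sum>E\<in>Pow D - {{}, D}. x ^ set_encode E))"
    proof -
      have "(\<Sum>E\<in>Pow D. x ^ set_encode E) = x ^ set_encode D + (\<Sum>E\<in>Pow D - {D}. x ^ set_encode E)"
        using finD by (intro sum.remove) auto
      also have "(\<Sum>E\<in>Pow D - {D}. x ^ set_encode E)
          = x ^ set_encode {} + (\<Sum>E\<in>Pow D - {D} - {{}}. x ^ set_encode E)"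
        using finD D(2) by (intro sum.remove) auto
      also have "Pow D - {D} - {{}} = Pow D - {{}, D}" by auto
      finally show ?thesis by (simp add: power_set_encode_plus_1[OF finD])
    qed
    then have "(\<Sum>E\<in>Pow D - {{}, D}. tr (x ^ set_encode E)) = 0"
      using f[of x] by (simp add: trace_add trace_1 trace_sum)
    moreover have "tr (x ^ set_encode E) = (\<Sum>i<m. x ^ set_encode (shift i E))" if "E \<subseteq> D" for E
      using that D(1) by (simp add: abs_trace_def power_set_encode_shift)
    ultimately show ?thesis by (simp add: I_def flip: sum.cartesian_product)
  qed
  have "even (card {p \<in> I. (case p of (E, i) \<Rightarrow> set_encode (shift i E)) = set_encode T})"
  proof (rule sum_powers_eq_0_imp_even)
    show "finite I" using finD by (simp add: I_def)
  qed (use zero T' in \<open>auto simp: case_prod_unfold intro: set_encode_less[OF shift_subset] set_encode_less\<close>)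
  also have "{p \<in> I. (case p of (E, i) \<Rightarrow> set_encode (shift i E)) = set_encode T}
      = {(E, i). (E, i) \<in> I \<and> shift i E = T}"
    using T' set_encode_inf finite_subset[OF shift_subset] finite_subset[OF T']
    by (auto simp: set_encode_eq)
  \<comment> \<open>The index \<open>i\<close> determines \<open>E\<close>, because shifting by
    \<open>i\<close> is injective on digits.\<close>
  also have "card \<dots> = card (snd ` \<dots>)"
  proof (rule card_image[symmetric], rule inj_onI)
    fix p p' assume *: "p \<in> {(E, i). (E, i) \<in> I \<and> shift i E = T}" "p' \<in> {(E, i). (E, i) \<in> I \<and> shift i E = T}"
      "snd p = snd p'"
    then obtain E E' i where p: "p = (E, i)" "p' = (E', i)" by (cases p; cases p') auto
    with * have "shift i E = shift i E'" "E \<subseteq> {..<m}" "E' \<subseteq> {..<m}" using D(1) by (auto simp: I_def)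
    then have "E = E'" using inj_on_image_eq_iff[OF inj_on_shift] by (auto simp: shift_def)
    then show "p = p'" by (simp add: p)
  qed
  also have "snd ` {(E, i). (E, i) \<in> I \<and> shift i E = T} = {i \<in> {..<m}. T \<subset> shift i D}" (is "?L = ?R")
  proof (intro equalityI subsetI)
    fix i assume "i \<in> ?L"
    then obtain E where "(E, i) \<in> I" "shift i E = T" by auto
    then have E: "E \<subseteq> D" "E \<noteq> D" "i < m" "T = shift i E" by (auto simp: I_def)
    moreover have "shift i E \<noteq> shift i D"
      using E D(1) inj_on_image_eq_iff[OF inj_on_shift, of E D] by (auto simp: shift_def)
    ultimately show "i \<in> ?R" by (auto simp: shift_def)
  next
    fix i assume i: "i \<in> ?R"
    then have "T \<subseteq> (\<lambda>j. (j + i) mod m) ` D" by (auto simp: shift_def)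
    then obtain E where "E \<subseteq> D" "T = shift i E" unfolding shift_def by (rule subset_imageE)
    moreover from this i T have "E \<noteq> {}" "E \<noteq> D" by (auto simp: shift_def)
    ultimately have "(E, i) \<in> {(E, i). (E, i) \<in> I \<and> shift i E = T}" using i by (simp add: I_def)
    then show "i \<in> ?L" by (rule image_eqI[rotated]) simp
  qed
  finally show ?thesis .
qed

lemma card_shift:
  assumes "D \<subseteq> {..<m}"
  shows "card (shift i D) = card D"
  unfolding shift_def using inj_on_subset[OF inj_on_shift assms] by (rule card_image)

text \<open>
  The shifts of \<open>D\<close> through a fixed point form a family of \<open>card D\<close> sets in which every set of at
  most \<open>card D - 2\<close> further points is covered evenly often; hence \<open>2 ^ (card D - 1) \<le> card D\<close>.
\<close>
lemma card_le_2_if_trace_derivative_constant: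
  assumes D: "D \<subseteq> {..<m}"
    and f: "\<And>x. tr (x ^ set_encode D + (x + 1) ^ set_encode D) = 1"
    and inj: "inj_on (\<lambda>i. shift i D) {..<m}"
  shows "card D \<le> 2"
proof (rule ccontr)
  assume "\<not> card D \<le> 2"
  then obtain r where r: "card D = r + 2" "r \<ge> 1"
    using nat_le_iff_add[of 3 "card D"] by force
  have D_ne: "D \<noteq> {}" using r by auto
  have finD: "finite D" using D finite_subset by blast
  define \<F> where "\<F> = {A \<in> (\<lambda>i. shift i D) ` {..<m}. 0 \<in> A}"
  have "even (card {A \<in> \<F>. S \<subseteq> A})" if S: "finite S" "card S \<le> r" for S
  proof -
    have "card (insert 0 S) < card D" using S r by (simp add: card_insert_if)
    \<comment> \<open>The covered set has fewer than \<open>card D\<close> elements, so it cannot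
      fill a shift, and the parity result for proper inclusion applies.\<close>
    then have proper: "insert 0 S \<subseteq> shift i D \<longleftrightarrow> insert 0 S \<subset> shift i D" for i
      using card_shift[OF D, of i] by (auto simp del: insert_subset)
    have "{A \<in> \<F>. S \<subseteq> A} = (\<lambda>i. shift i D) ` {i \<in> {..<m}. insert 0 S \<subseteq> shift i D}"
      by (auto simp: \<F>_def)
    also have "\<dots> = (\<lambda>i. shift i D) ` {i \<in> {..<m}. insert 0 S \<subset> shift i D}"
      by (simp only: proper)
    finally have "{A \<in> \<F>. S \<subseteq> A} = \<dots>" .
    moreover have "card \<dots> = card {i \<in> {..<m}. insert 0 S \<subset> shift i D}"
      by (rule card_image) (rule inj_on_subset[OF inj], auto)
    ultimately show ?thesis using even_covering_shifts[OF D D_ne f, of "insert 0 S"] by simp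
  qed
  moreover have "finite \<F>" by (simp add: \<F>_def)
  moreover have "\<F> \<noteq> {}"
  proof -
    obtain j where j: "j \<in> D" using D_ne by blast
    then have "j < m" using D by auto
    \<comment> \<open>The shift by \<open>m - j\<close> moves the digit \<open>j\<close> to
      \<open>0\<close>; the inner \<open>mod m\<close> keeps the index below \<open>m\<close> when
      \<open>j = 0\<close>.\<close>
    then have "(j + (m - j) mod m) mod m = 0" by (simp add: mod_simps)
    then have "0 \<in> shift ((m - j) mod m) D" using j by (force simp: shift_def)
    then show ?thesis using m_pos by (auto simp: \<F>_def)
  qed
  ultimately have "2 ^ Suc r \<le> card \<F>" by (intro card_ge_two_power_if_covers_even) auto
  also have "card \<F> \<le> card D"
  proof -
    have "\<F> \<subseteq> (\<lambda>j. shift ((m - j) mod m) D) ` D"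
    proof
      fix A assume "A \<in> \<F>"
      then obtain i j where ij: "i < m" "A = shift i D" "j \<in> D" "(j + i) mod m = 0"
        by (auto simp: \<F>_def shift_def)
      moreover have "i = (m - j) mod m"
      proof -
        have "j < m" using ij D by auto
        have "(j + i) mod m = (j + (m - j) mod m) mod m" using ij \<open>j < m\<close> by (simp add: mod_simps)
        then have "i mod m = (m - j) mod m"
          using cong_add_lcancel_nat[of j i "(m - j) mod m" m] by (simp add: cong_def)
        then show ?thesis using ij by simp
      qed
      ultimately show "A \<in> (\<lambda>j. shift ((m - j) mod m) D) ` D" by auto
    qed
    then show ?thesis using finD by (rule surj_card_le[rotated])
  qed
  finally have "2 ^ Suc r \<le> r + 2" using r by simp
  moreover have "r + 2 < 2 ^ Suc r"
    using r(2) by (induction r rule: dec_induct) auto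
  ultimately show False by simp
qed


section \<open>Reduced exponents and elements fixed by Frobenius powers\<close>

lemma power_mod_order:
  assumes "(x::'a) \<noteq> 0"
  shows "x ^ (n mod (2 ^ m - 1)) = x ^ n"
proof -
  have "x ^ (2 ^ m - 1) * x = x"
    using power_field_card[of x] by (simp flip: power_Suc2)
  then have "x ^ (2 ^ m - 1) = 1" using assms by simp
  moreover have "x ^ n = x ^ (n mod (2 ^ m - 1)) * (x ^ (2 ^ m - 1)) ^ (n div (2 ^ m - 1))"
    by (simp flip: power_mult power_add)
  ultimately show ?thesis by simp
qed

text \<open>Positivity of both exponents takes care of \<open>x = 0\<close>, where the exponent
  \<open>0\<close> would give \<open>1\<close>.\<close>

lemma power_cong:
  assumes "[d = e] (mod (2 ^ m - 1))" "d > 0" "e > 0"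
  shows "(x::'a) ^ d = x ^ e"
proof (cases "x = 0")
  case False
  then show ?thesis
    using assms(1) power_mod_order[of x d] power_mod_order[of x e] by (simp add: cong_def)
qed (use assms in \<open>simp add: zero_power\<close>)

lemma frobenius_fixed_iterate:
  assumes "(x::'a) ^ 2 ^ g = x"
  shows "x ^ 2 ^ (g * t) = x"
  by (induction t) (simp_all add: assms power_add power_mult)

text \<open>By Bezout, an element fixed by the \<open>k\<close>-th and the \<open>m\<close>-th
  iterate of the Frobenius map is fixed by the Frobenius map itself.\<close>

lemma frobenius_fixed_coprime:
  assumes "(x::'a) ^ 2 ^ k = x" "coprime k m" "m \<noteq> 1"
  shows "x = 0 \<or> x = 1"
proof -
  obtain s t where st: "k * s = m * t + 1"
    using coprime_bezout_strong[OF assms(2,3)] by blast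
  have "x = x ^ 2 ^ (m * t + 1)"
    using frobenius_fixed_iterate[OF assms(1), of s] by (simp only: st)
  also have "\<dots> = x * x"
    using frobenius_fixed_iterate[of x m t] by (simp add: power_mult power2_eq_square mult.commute[of 2])
  finally show ?thesis by simp
qed

text \<open>The relative trace to the subfield fixed by \<open>x \<mapsto> x ^ 2 ^ g\<close> is not \<open>{0, 1}\<close>-valued.\<close>
lemma ex_frobenius_fixed:
  assumes "g dvd m" "g \<noteq> 1"
  shows "\<exists>x::'a. x ^ 2 ^ g = x \<and> x \<noteq> 0 \<and> x \<noteq> 1"
proof -
  obtain r where r: "m = g * r" using assms(1) by (auto elim: dvdE)
  have g: "g \<ge> 2" using assms(2) m_pos r by (cases g) auto
  define t :: "'a \<Rightarrow> 'a" where "t x = (\<Sum>i<r. x ^ 2 ^ (g * i))" for x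
  have fixed: "t x ^ 2 ^ g = t x" for x
  proof -
    have "t x ^ 2 ^ g = (\<Sum>i<r. x ^ 2 ^ (g * Suc i))"
      by (simp add: t_def freshmans_dream_sum'[OF CHAR_prime] char_two power_add mult.commute flip: power_mult)
    also have "\<dots> = t x"
      using sum.lessThan_Suc_shift[of "\<lambda>i. x ^ 2 ^ (g * i)" r]
        sum.lessThan_Suc[of "\<lambda>i. x ^ 2 ^ (g * i)" r] power_field_card[of x]
      by (simp add: t_def r add.commute)
    finally show ?thesis .
  qed
  have "\<exists>x. t x \<noteq> 0 \<and> t x \<noteq> 1"
  proof (rule ccontr)
    assume "\<not> ?thesis"
    \<comment> \<open>Otherwise this sum would vanish identically. As \<open>g \<ge> 2\<close>, the
      exponent \<open>1\<close> occurs in it exactly once, which contradicts the parity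
      count.\<close>
    then have t01: "t x + (t x)\<^sup>2 = 0" for x by (metis add_self power_one zero_power2)
    define e where "e p = (2::nat) ^ (g * fst p + snd p)" for p
    have "t x + (t x)\<^sup>2 = (\<Sum>i<r. \<Sum>b\<in>{0, 1}. x ^ e (i, b))" for x
      using freshmans_dream_sum'[OF CHAR_prime, of 2 1 "\<lambda>i. x ^ 2 ^ (g * i)" "{..<r}"]
      by (simp add: t_def e_def char_two sum.distrib mult.commute flip: power_mult)
    then have "(\<Sum>p\<in>{..<r} \<times> {0, 1}. x ^ e p) = 0" for x :: 'a
      using t01[of x] by (simp add: sum.cartesian_product case_prod_unfold del: sum.insert)
    moreover have "e p < 2 ^ m" if "p \<in> {..<r} \<times> {0, 1}" for p
    proof -
      have "g * fst p + snd p < g * Suc (fst p)" using that g by auto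
      also have "\<dots> \<le> m" unfolding r using that by (intro mult_le_mono) auto
      finally show ?thesis by (simp add: e_def)
    qed
    ultimately have "even (card {p \<in> {..<r} \<times> {0, 1}. e p = 1})"
      using one_less_power[of "2::nat" m] m_pos by (intro sum_powers_eq_0_imp_even) auto
    moreover have "{p \<in> {..<r} \<times> {0, 1}. e p = 1} = {(0, 0)}"
      using g r m_pos by (auto simp: e_def)
    ultimately show False by simp
  qed
  then show ?thesis using fixed by blast
qed

text \<open>The shifts of the digit set are distinct because \<open>x ^ d\<close> is onto and the
  Frobenius powers are distinct, so \<open>d\<close> has at most two digits modulo
  \<open>2 ^ m - 1\<close>. Almost perfect nonlinearity excludes a single digit and a common factor
  of \<open>k\<close> and \<open>m\<close>.\<close>

lemma trace_derivative_1_imp_gold: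
  assumes mn: "maximum_nonlinear m (\<lambda>x::'a. x ^ d)" and m: "m \<noteq> 1"
    and f: "\<And>x::'a. tr (x ^ d + (x + 1) ^ d) = 1"
  shows "gold_exponent m d"
proof -
  note bij = maximum_nonlinear_power_bij[OF mn m]
  define d' where "d' = d mod (2 ^ m - 1)"
  have m3: "m \<ge> 3" using m odd_m m_pos by (auto elim!: oddE)
  then have "(2::nat) ^ 3 \<le> 2 ^ m" by (intro power_increasing) auto
  then have q8: "(8::nat) \<le> 2 ^ m" by simp
  have "\<not> UNIV \<subseteq> {0, 1 :: 'a}"
    using card_mono[of "{0, 1 :: 'a}" UNIV] q8 card_field by auto
  then obtain a :: 'a where a: "a \<noteq> 0" "a \<noteq> 1" by blast
  have "a ^ d \<noteq> 1"
    using maximum_nonlinear_power_root[OF mn] a by blast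
  then have "d' > 0"
    using power_mod_order[OF a(1), of d] by (auto simp: d'_def intro!: Nat.gr0I)
  then have pow: "(x::'a) ^ d = x ^ d'" for x
    using bij(1) by (intro power_cong) (auto simp: d'_def cong_def)
  define D where "D = set_decode d'"
  have enc: "set_encode D = d'" by (simp add: D_def)
  have finD: "finite D" by (simp add: D_def)
  have "d' < 2 ^ m" using q8 by (simp add: d'_def less_le_trans[OF mod_less_divisor])
  have D: "D \<subseteq> {..<m}"
  proof
    fix j assume "j \<in> D"
    then have "2 ^ j \<le> set_encode D"
      unfolding set_encode_def using finD by (intro member_le_sum) auto
    then have "(2::nat) ^ j < 2 ^ m" using enc \<open>d' < 2 ^ m\<close> by linarith
    then show "j \<in> {..<m}" by simp
  qed
  have "inj_on (\<lambda>i. shift i D) {..<m}"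
  proof (rule inj_onI)
    fix i j assume ij: "i \<in> {..<m}" "j \<in> {..<m}" "shift i D = shift j D"
    have "y ^ 2 ^ i = y ^ 2 ^ j" for y :: 'a
    proof -
      obtain x where "y = x ^ d" using bij(2) by (metis bij_pointE)
      then show ?thesis
        using ij(3) power_set_encode_shift[OF D, of x i] power_set_encode_shift[OF D, of x j]
        by (simp add: pow enc)
    qed
    then show "i = j" using frobenius_powers_distinct ij by simp
  qed
  then have "card D \<le> 2"
    by (intro card_le_2_if_trace_derivative_constant[OF D]) (use f in \<open>simp_all add: enc pow\<close>)
  moreover have "card D \<noteq> 0" using \<open>d' > 0\<close> enc finD by auto
  moreover have "card D \<noteq> 1"
  proof
    assume "card D = 1"
    \<comment> \<open>With one digit the power function is additive, so its derivatives are
      constant.\<close>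
    then obtain j where "D = {j}" by (auto simp: card_1_singleton_iff)
    then have "d' = 2 ^ j" using enc by simp
    then have "a = 0 \<or> a = 0 + 1"
      by (intro maximum_nonlinear_derivative[OF mn]) (simp_all add: pow frobenius_add)
    then show False using a by simp
  qed
  ultimately have "card D = 2" by linarith
  then obtain b c where bc: "D = {b, c}" "b \<noteq> c" by (auto simp: card_2_iff)
  define i j where "i = min b c" and "j = max b c"
  have "D = {i, j}" "i < j" using bc by (auto simp: i_def j_def min_def max_def)
  define k where "k = j - i"
  have d': "d' = 2 ^ i * (2 ^ k + 1)"
    using enc \<open>D = {i, j}\<close> \<open>i < j\<close> by (simp add: k_def distrib_left flip: power_add)
  have "coprime k m"
  proof (rule ccontr)
    assume "\<not> coprime k m"
    then have "gcd k m \<noteq> 1" by (simp add: coprime_iff_gcd_eq_1)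
    then obtain z :: 'a where z: "z ^ 2 ^ gcd k m = z" "z \<noteq> 0" "z \<noteq> 1"
      using ex_frobenius_fixed[of "gcd k m"] by auto
    have zk: "z ^ 2 ^ k = z"
      using frobenius_fixed_iterate[OF z(1), of "k div gcd k m"] by simp
    \<comment> \<open>On the fixed field of the \<open>k\<close>-th Frobenius iterate the power
      function is additive, so the derivative in direction \<open>1\<close> takes the same value at
      \<open>z\<close> as at \<open>0\<close>.\<close>
    have "z ^ d' + (z + 1) ^ d' = 1"
    proof -
      have "z ^ d' + (z + 1) ^ d' = (z * z) ^ 2 ^ i + ((z + 1) * (z + 1)) ^ 2 ^ i"
        by (simp add: d' power_mult mult.commute[of "2 ^ i"] power_add power_mult_distrib frobenius_add zk)
      also have "\<dots> = (z * z + (z + 1) * (z + 1)) ^ 2 ^ i" by (rule frobenius_add[symmetric])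
      also have "z * z + (z + 1) * (z + 1) = 1" by (simp add: algebra_simps)
      finally show ?thesis by simp
    qed
    then have "z = 0 \<or> z = 0 + 1"
      using \<open>d' > 0\<close>
      by (intro maximum_nonlinear_derivative[OF mn]) (simp_all add: pow)
    then show False using z by simp
  qed
  moreover have "[d = 2 ^ i * (2 ^ k + 1)] (mod (2 ^ m - 1))"
    unfolding d'[symmetric] by (simp add: cong_def d'_def)
  ultimately show ?thesis by (auto simp: gold_exponent_def)
qed

subsection \<open>The Walsh transform of a power function\<close>

definition walsh :: "nat \<Rightarrow> 'a \<Rightarrow> int"
  where "walsh d a = ft (\<lambda>x. \<chi> (x ^ d)) a"

lemma walsh_0:
  assumes "bij (\<lambda>x::'a. x ^ d)"
  shows "walsh d 0 = 0"
proof -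
  have "walsh d 0 = (\<Sum>x\<in>UNIV. \<chi> (x ^ d))" by (simp add: walsh_def ft_def)
  also have "\<dots> = (\<Sum>y\<in>UNIV. \<chi> y)" by (rule sum.reindex_bij_betw[OF assms])
  also have "\<dots> = 0" using sum_chi_mult[of 1] by simp
  finally show ?thesis .
qed

text \<open>The function is quadratic, so its derivative in direction \<open>u\<close> is affine,
  and the autocorrelation vanishes unless the linear part does. This leaves \<open>u = 0\<close> and
  \<open>u = 1\<close>; at \<open>u = 1\<close> the factor \<open>\<chi> 1 = -1\<close> gives the
  sign.\<close>

lemma gold_walsh_square:
  assumes "coprime k m" "m \<noteq> 1" and pow: "\<And>x::'a. x ^ d = (x ^ (2 ^ k + 1)) ^ 2 ^ s"
  shows "(walsh d a)\<^sup>2 = 2 ^ m * (1 - \<chi> a)"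
proof -
  define F :: "'a \<Rightarrow> 'a" where "F x = x ^ (2 ^ k + 1)" for x
  have correlation: "autocorrelation (\<lambda>x. \<chi> (x ^ d)) u = (if u = 0 then 2 ^ m else if u = 1 then - (2 ^ m) else 0)" for u
  proof -
    have "\<chi> (x ^ d) * \<chi> ((x + u) ^ d) = \<chi> (F u) * \<chi> ((u ^ 2 ^ (2 * k) + u) * x ^ 2 ^ k)" for x
    proof -
      have "\<chi> (x ^ d) * \<chi> ((x + u) ^ d) = \<chi> (F x + F (x + u))"
        by (simp add: pow chi_frobenius chi_add F_def)
      also have "F x + F (x + u) = F u + (x * u ^ 2 ^ k + x ^ 2 ^ k * u)"
        by (simp add: F_def frobenius_add algebra_simps)
      \<comment> \<open>The character is Frobenius invariant, so one term may be raised to the power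
        \<open>2 ^ k\<close>; both terms then share the factor \<open>x ^ 2 ^ k\<close>.\<close>
      also have "\<chi> \<dots> = \<chi> (F u) * (\<chi> ((x * u ^ 2 ^ k) ^ 2 ^ k) * \<chi> (x ^ 2 ^ k * u))"
        by (simp add: chi_add chi_frobenius)
      also have "\<dots> = \<chi> (F u) * \<chi> ((u ^ 2 ^ (2 * k) + u) * x ^ 2 ^ k)"
      proof -
        have "u ^ 2 ^ (2 * k) = (u ^ 2 ^ k) ^ 2 ^ k"
          by (simp add: mult_2 power_add power_mult)
        then have eq: "(x * u ^ 2 ^ k) ^ 2 ^ k + x ^ 2 ^ k * u = (u ^ 2 ^ (2 * k) + u) * x ^ 2 ^ k"
          by (simp only: power_mult_distrib) (simp only: algebra_simps)
        show ?thesis unfolding eq[symmetric] chi_add ..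
      qed
      finally show ?thesis .
    qed
    then have "autocorrelation (\<lambda>x. \<chi> (x ^ d)) u
        = \<chi> (F u) * (\<Sum>x\<in>UNIV. \<chi> ((u ^ 2 ^ (2 * k) + u) * x ^ 2 ^ k))"
      by (simp add: autocorrelation_def sum_distrib_left)
    also have "(\<Sum>x\<in>UNIV. \<chi> ((u ^ 2 ^ (2 * k) + u) * x ^ 2 ^ k))
        = (\<Sum>y\<in>UNIV. \<chi> ((u ^ 2 ^ (2 * k) + u) * y))"
      by (rule sum.reindex_bij_betw[OF frobenius_bij])
    also have "\<dots> = (if u = 0 \<or> u = 1 then 2 ^ m else 0)"
    proof -
      have "coprime (2 * k) m" using assms(1) odd_m by (simp add: coprime_left_2_iff_odd)
      then have "u ^ 2 ^ (2 * k) = u \<longleftrightarrow> u = 0 \<or> u = 1"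
        using frobenius_fixed_coprime[of u "2 * k"] assms(2) by auto
      then show ?thesis by (simp add: sum_chi_mult)
    qed
    finally show ?thesis by (auto simp: F_def)
  qed
  have "(walsh d a)\<^sup>2 = (\<Sum>u\<in>UNIV. autocorrelation (\<lambda>x. \<chi> (x ^ d)) u * \<chi> (a * u))"
    by (simp only: walsh_def ft_square) (simp only: ft_def)
  also have "\<dots> = (\<Sum>u\<in>{0, 1}. autocorrelation (\<lambda>x. \<chi> (x ^ d)) u * \<chi> (a * u))"
    by (rule sum.mono_neutral_right) (auto simp: correlation)
  also have "\<dots> = 2 ^ m * (1 - \<chi> a)"
    by (simp add: correlation algebra_simps)
  finally show ?thesis .
qed

lemma gold_walsh_parity:
  assumes "gold_exponent m d" "m \<noteq> 1" "d > 0"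
  shows "(walsh d (a + b) = 0) = ((walsh d a = 0) = (walsh d b = 0))"
proof -
  obtain k s where k: "coprime k m" "[d = 2 ^ s * (2 ^ k + 1)] (mod (2 ^ m - 1))"
    using assms(1) by (auto simp: gold_exponent_def)
  have "(x::'a) ^ d = (x ^ (2 ^ k + 1)) ^ 2 ^ s" for x
  proof -
    have "x ^ d = x ^ (2 ^ s * (2 ^ k + 1))" by (rule power_cong[OF k(2) assms(3)]) simp
    also have "\<dots> = x ^ ((2 ^ k + 1) * 2 ^ s)" by (simp only: mult.commute)
    finally show ?thesis by (simp only: power_mult)
  qed
  from gold_walsh_square[OF k(1) assms(2) this]
  have "(walsh d c)\<^sup>2 = 2 ^ m * (1 - \<chi> c)" for c .
  then have "(walsh d c)\<^sup>2 = 0 \<longleftrightarrow> \<chi> c = 1" for c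
    by simp
  then have zero: "walsh d c = 0 \<longleftrightarrow> \<chi> c = 1" for c
    by simp
  show ?thesis
    unfolding zero chi_add using chi_cases[of a] chi_cases[of b] by auto
qed

lemma walsh_frobenius: "walsh d (a\<^sup>2) = walsh d a"
proof -
  have "walsh d (a\<^sup>2) = (\<Sum>x\<in>UNIV. \<chi> ((x ^ 2 ^ 1) ^ d) * \<chi> (a\<^sup>2 * x ^ 2 ^ 1))"
    unfolding walsh_def ft_def by (rule sum.reindex_bij_betw[OF frobenius_bij, symmetric])
  also have "\<dots> = (\<Sum>x\<in>UNIV. \<chi> ((x ^ d) ^ 2 ^ 1) * \<chi> ((a * x) ^ 2 ^ 1))"
    by (simp add: power_mult_distrib mult.commute flip: power_mult)
  also have "\<dots> = walsh d a"
    unfolding chi_frobenius by (simp add: walsh_def ft_def)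
  finally show ?thesis .
qed

text \<open>By Fourier inversion at \<open>0\<close> some coefficient \<open>ft \<psi> c\<close> is
  nonzero. It is the sum of the character \<open>\<psi> x * \<chi> (c * x)\<close>, which must
  therefore be trivial.\<close>

lemma additive_character_representation:
  fixes \<psi> :: "'a \<Rightarrow> int"
  assumes add: "\<And>a b. \<psi> (a + b) = \<psi> a * \<psi> b" and "\<psi> 0 = 1"
  obtains c where "\<And>a. \<psi> a = \<chi> (c * a)"
proof -
  have "(\<Sum>c\<in>UNIV. ft \<psi> c) = 2 ^ m"
    using ft_inversion[of \<psi> 0] assms(2) by simp
  then obtain c where c: "ft \<psi> c \<noteq> 0"
    using sum.neutral[of UNIV "ft \<psi>"] by fastforce
  have "\<psi> a = \<chi> (c * a)" for a
  proof -
    have "\<psi> a * \<chi> (c * a) = 1"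
      using sum_additive_character[of "\<lambda>x. \<psi> x * \<chi> (c * x)" a] c
      by (auto simp: ft_def add distrib_left chi_add)
    then show ?thesis using chi_cases[of "c * a"] by auto
  qed
  then show thesis using that by blast
qed

lemma walsh_parseval: "(\<Sum>a\<in>UNIV. (walsh d a)\<^sup>2) = 2 ^ m * 2 ^ m"
  unfolding walsh_def parseval using card_field by (simp add: power2_eq_square)

text \<open>
  The additive character that is \<open>1\<close> exactly on the zeros of the Walsh transform is invariant
  under \<open>a \<mapsto> a\<^sup>2\<close>, hence it is \<open>\<chi>\<close>. By Fourier inversion of the squared transform,
  \<open>tr (x ^ d)\<close> has the linear structure \<open>1\<close>.
\<close>
lemma walsh_parity_imp_trace_derivative_1:
  assumes parity: "\<And>a b. (walsh d (a + b) = 0) = ((walsh d a = 0) = (walsh d b = 0))"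
  shows "tr (x ^ d + (x + 1) ^ d) = 1"
proof -
  define \<psi> where "\<psi> a = (if walsh d a = 0 then 1 else - 1 :: int)" for a
  have "walsh d 0 = 0" using parity[of 0 0] by simp
  obtain c where c: "\<psi> a = \<chi> (c * a)" for a
  proof (rule additive_character_representation[of \<psi>])
    show "\<psi> (a + b) = \<psi> a * \<psi> b" for a b using parity[of a b] by (auto simp: \<psi>_def)
    show "\<psi> 0 = 1" using \<open>walsh d 0 = 0\<close> by (simp add: \<psi>_def)
  qed blast
  have "\<chi> ((c + c\<^sup>2) * y) = 1" for y
  proof -
    obtain a where a: "y = a\<^sup>2" using frobenius_bij[of 1] by (metis bij_pointE power_one_right)
    have "\<chi> (c * a\<^sup>2) = \<psi> (a\<^sup>2)" by (simp add: c)
    also have "\<dots> = \<psi> a" by (simp add: \<psi>_def walsh_frobenius)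
    also have "\<dots> = \<chi> (c\<^sup>2 * a\<^sup>2)"
      using chi_frobenius[of "c * a" 1] by (simp add: c power_mult_distrib)
    finally show ?thesis by (simp add: a distrib_right chi_add)
  qed
  then have "c + c\<^sup>2 = 0"
    using sum_chi_mult[of "c + c\<^sup>2"] card_field by (auto split: if_splits)
  then have "c * (c + 1) = 0" by (simp add: power2_eq_square distrib_left add.commute)
  then have "c = 0 \<or> c = 1" by simp
  moreover have "c \<noteq> 0"
  proof
    assume "c = 0"
    then have "walsh d a = 0" for a using c[of a] by (simp add: \<psi>_def split: if_splits)
    then show False using walsh_parseval[of d] by simp
  qed
  ultimately have "\<psi> = \<chi>" using c by (simp add: fun_eq_iff)
  then have "\<chi> a = (if walsh d a = 0 then 1 else - 1)" for a
    by (simp add: \<psi>_def fun_eq_iff)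
  \<comment> \<open>Wherever the transform does not vanish, \<open>\<chi>\<close> is
    \<open>-1\<close>. The autocorrelation at \<open>1\<close> therefore attains its least possible
    value.\<close>
  then have "(walsh d a)\<^sup>2 * \<chi> (a * 1) = - (walsh d a)\<^sup>2" for a
    by simp
  then have "(\<Sum>a\<in>UNIV. (walsh d a)\<^sup>2 * \<chi> (a * 1)) = - (2 ^ m * 2 ^ m)"
    by (simp add: sum_negf walsh_parseval)
  also have "(\<Sum>a\<in>UNIV. (walsh d a)\<^sup>2 * \<chi> (a * 1)) = 2 ^ m * autocorrelation (\<lambda>x. \<chi> (x ^ d)) 1"
    unfolding walsh_def ft_square by (rule ft_inversion)
  finally have "2 ^ m * autocorrelation (\<lambda>x. \<chi> (x ^ d)) 1 = 2 ^ m * - (2 ^ m)" by simp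
  then have "autocorrelation (\<lambda>x. \<chi> (x ^ d)) 1 = - (2 ^ m)"
    unfolding mult_cancel_left by simp
  then have "(\<Sum>x::'a\<in>UNIV. 1 + \<chi> (x ^ d + (x + 1) ^ d)) = 0"
    using card_field by (simp add: autocorrelation_def chi_add sum.distrib)
  moreover have "0 \<le> 1 + \<chi> y" for y using chi_cases[of y] by auto
  ultimately have "1 + \<chi> (x ^ d + (x + 1) ^ d) = 0"
    by (simp add: sum_nonneg_eq_0_iff)
  then show ?thesis by (simp add: trace_eq_1_iff)
qed

section \<open>Intersection sizes in terms of the Walsh transform\<close>

text \<open>Twice the indicator of \<open>tr y = t\<close> is
  \<open>1 + neg_one_pow t * \<chi> y\<close>. The product of three indicators expands into eight
  sums: four are linear character sums contributing only \<open>2 ^ m\<close>, the others are Walsh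
  values, of which the one at \<open>0\<close> vanishes.\<close>

lemma card_H_set_trace_one:
  assumes "i \<in> {0, 1}" "j \<in> {0, 1}" "\<alpha> \<noteq> 0" "\<beta> \<noteq> 0" "\<alpha> \<noteq> \<beta>"
    and bij: "bij (\<lambda>x::'a. x ^ d)"
  shows "8 * int (card (H_set m i j \<alpha> \<beta> \<inter> trace_one_set m d :: 'a set))
    = 2 ^ m - (neg_one_pow i * walsh d \<alpha> + neg_one_pow j * walsh d \<beta>
        + neg_one_pow i * neg_one_pow j * walsh d (\<alpha> + \<beta>))"
proof -
  define I J where "I = neg_one_pow i" and "J = neg_one_pow j"
  let ?S = "H_set m i j \<alpha> \<beta> \<inter> trace_one_set m d"
  have trace_eq: "2 * of_bool (tr y = t) = 1 + neg_one_pow t * \<chi> y" if "t \<in> {0, 1}" for y t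
    using that trace_prime_field[of y] by (auto simp: \<chi>_def neg_one_pow_def)
  have trace_eq_1: "2 * of_bool (tr y = 1) = 1 - \<chi> y" for y
    using trace_eq[of 1 y] by (simp add: neg_one_pow_def)
  have ind: "8 * of_bool (x \<in> ?S) = (1 + I * \<chi> (\<alpha> * x)) * (1 + J * \<chi> (\<beta> * x)) * (1 - \<chi> (x ^ d))" for x
  proof -
    have "8 * of_bool (x \<in> ?S) = (2 * of_bool (tr (\<alpha> * x) = i)) * (2 * of_bool (tr (\<beta> * x) = j))
        * (2 * of_bool (tr (x ^ d) = 1) :: int)"
      by (auto simp: H_set_def trace_one_set_def)
    then show ?thesis
      by (simp only: trace_eq[OF assms(1)] trace_eq[OF assms(2)] trace_eq_1 I_def J_def)
  qed
  have "8 * int (card ?S) = (\<Sum>x\<in>UNIV. 8 * of_bool (x \<in> ?S))"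
    by (simp add: Int_def flip: sum_distrib_left)
  also have "\<dots> = (\<Sum>x\<in>UNIV. 1 + I * \<chi> (\<alpha> * x) + J * \<chi> (\<beta> * x) + I * J * \<chi> ((\<alpha> + \<beta>) * x)
      - (\<chi> (x ^ d) * \<chi> (0 * x) + I * (\<chi> (x ^ d) * \<chi> (\<alpha> * x)) + J * (\<chi> (x ^ d) * \<chi> (\<beta> * x))
        + I * J * (\<chi> (x ^ d) * \<chi> ((\<alpha> + \<beta>) * x))))"
  proof (intro sum.cong refl)
    fix x :: 'a
    have expand: "(1 + I * A) * (1 + J * B) * (1 - C) = 1 + I * A + J * B + I * J * (A * B)
        - (C * 1 + I * (C * A) + J * (C * B) + I * J * (C * (A * B)))" for A B C :: int
      by (simp add: algebra_simps)
    have "\<chi> ((\<alpha> + \<beta>) * x) = \<chi> (\<alpha> * x) * \<chi> (\<beta> * x)" by (simp add: distrib_right chi_add)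
    then show "8 * of_bool (x \<in> ?S)
      = 1 + I * \<chi> (\<alpha> * x) + J * \<chi> (\<beta> * x) + I * J * \<chi> ((\<alpha> + \<beta>) * x)
      - (\<chi> (x ^ d) * \<chi> (0 * x) + I * (\<chi> (x ^ d) * \<chi> (\<alpha> * x)) + J * (\<chi> (x ^ d) * \<chi> (\<beta> * x))
        + I * J * (\<chi> (x ^ d) * \<chi> ((\<alpha> + \<beta>) * x)))"
      by (simp only: ind expand mult_zero_left chi_0)
  qed
  also have "\<dots> = 2 ^ m - (walsh d 0 + I * walsh d \<alpha> + J * walsh d \<beta> + I * J * walsh d (\<alpha> + \<beta>))"
    using assms(3-5) card_field
    by (simp only: sum.distrib sum_subtractf walsh_def ft_def sum_chi_mult flip: sum_distrib_left) simp
  finally show ?thesis by (simp add: walsh_0[OF bij] I_def J_def)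
qed

text \<open>With \<open>m = 2 * p + 3\<close> the positive square root of \<open>2 * 2 ^ m\<close>
  is \<open>4 * 2 ^ p\<close>.\<close>

lemma walsh_values:
  assumes mn: "maximum_nonlinear m (\<lambda>x::'a. x ^ d)" and "m = 2 * p + 3"
  obtains w where "walsh d a = 4 * 2 ^ p * w" "w \<in> {-1, 0, 1}"
proof -
  have "component (\<lambda>x. x ^ d) 1 = (\<lambda>x. \<chi> (x ^ d))" by (simp add: component_def fun_eq_iff)
  then have "(walsh d a)\<^sup>2 \<in> {0, 2 * 2 ^ m}"
    using maximum_nonlinear_ft_square[OF mn, of 1 a] by (simp add: walsh_def)
  moreover have "2 * 2 ^ m = (4 * 2 ^ p :: int)\<^sup>2"
    by (simp add: assms(2) power_add power_mult power2_eq_square flip: power_mult_distrib)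
  ultimately have "walsh d a = 0 \<or> (walsh d a)\<^sup>2 = (4 * 2 ^ p)\<^sup>2" by auto
  then have "walsh d a \<in> {4 * 2 ^ p * (-1), 4 * 2 ^ p * 0, 4 * 2 ^ p * 1}"
    unfolding power2_eq_iff by auto
  then show thesis using that by blast
qed

text \<open>In units of \<open>4 * 2 ^ p\<close> the Walsh values are \<open>u\<close>,
  \<open>v\<close>, \<open>w\<close> in \<open>{-1, 0, 1}\<close>, and the sizes are admissible iff
  every relevant signed sum is \<open>0\<close> or \<open>\<plusminus>2\<close>. Signs do not affect
  parity and the sums are at most \<open>3\<close> in modulus, so this says that evenly many of the
  three are nonzero.\<close>

lemma card_values_iff_walsh_parity:
  assumes mn: "maximum_nonlinear m (\<lambda>x::'a. x ^ d)" and p: "m = 2 * p + 3"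
    and \<alpha>\<beta>: "\<alpha> \<noteq> 0" "\<beta> \<noteq> 0" "\<alpha> \<noteq> \<beta>"
  shows "(\<forall>i\<in>{0, 1}. \<forall>j\<in>{0, 1}.
      real (card (H_set m i j \<alpha> \<beta> \<inter> trace_one_set m d :: 'a set)) \<in>
        {2 powr (real m - 3),
         2 powr (real m - 3) + 2 powr ((real m - 3) / 2),
         2 powr (real m - 3) - 2 powr ((real m - 3) / 2)})
    \<longleftrightarrow> (walsh d (\<alpha> + \<beta>) = 0) = ((walsh d \<alpha> = 0) = (walsh d \<beta> = 0))"
proof -
  have bij: "bij (\<lambda>x::'a. x ^ d)"
    using maximum_nonlinear_power_bij[OF mn] p by simp
  define P :: real where "P = 2 ^ p"
  have P: "P > 0" by (simp add: P_def)
  have "2 powr real (2 * p) = P * P"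
    by (subst powr_realpow) (simp_all add: P_def mult_2 power_add)
  then have powr1: "2 powr (real m - 3) = P * P" by (simp add: p)
  have "2 powr real p = P" by (subst powr_realpow) (simp_all add: P_def)
  then have powr2: "2 powr ((real m - 3) / 2) = P" by (simp add: p)
  obtain u where u: "walsh d \<alpha> = 4 * 2 ^ p * u" "u \<in> {-1, 0, 1}"
    by (rule walsh_values[OF mn p, of "\<alpha>"])
  obtain v where v: "walsh d \<beta> = 4 * 2 ^ p * v" "v \<in> {-1, 0, 1}"
    by (rule walsh_values[OF mn p, of "\<beta>"])
  obtain w where w: "walsh d (\<alpha> + \<beta>) = 4 * 2 ^ p * w" "w \<in> {-1, 0, 1}"
    by (rule walsh_values[OF mn p, of "\<alpha> + \<beta>"])
  have card_value: "real (card (H_set m i j \<alpha> \<beta> \<inter> trace_one_set m d)) \<in> {P * P, P * P + P, P * P - P}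
      \<longleftrightarrow> neg_one_pow i * u + neg_one_pow j * v + neg_one_pow i * neg_one_pow j * w \<in> {0, 2, -2}"
    if ij: "i \<in> {0, 1}" "j \<in> {0, 1}" for i j :: 'a
  proof -
    define t where "t = neg_one_pow i * u + neg_one_pow j * v + neg_one_pow i * neg_one_pow j * w"
    define N where "N = card (H_set m i j \<alpha> \<beta> \<inter> trace_one_set m d)"
    have "8 * int N = 8 * (2 ^ p * 2 ^ p) - 4 * 2 ^ p * t"
    proof -
      have "(2::int) ^ m = 8 * (2 ^ p * 2 ^ p)" by (simp add: p power_add power_even_eq power2_eq_square)
      then show ?thesis
        using card_H_set_trace_one[OF ij \<alpha>\<beta> bij] by (simp add: N_def t_def u(1) v(1) w(1) algebra_simps)
    qed
    then have "real_of_int (8 * int N) = real_of_int (8 * (2 ^ p * 2 ^ p) - 4 * 2 ^ p * t)" by simp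
    then have N: "2 * real N = 2 * (P * P) - P * real_of_int t" by (simp add: P_def)
    have "real N = P * P \<longleftrightarrow> P * real_of_int t = P * 0"
      and "real N = P * P + P \<longleftrightarrow> P * real_of_int t = P * (-2)"
      and "real N = P * P - P \<longleftrightarrow> P * real_of_int t = P * 2"
      using N by linarith+
    then show ?thesis
      using P unfolding mult_cancel_left by (simp flip: N_def t_def) (auto simp flip: of_int_eq_iff)
  qed
  have "(\<forall>i\<in>{0, 1}. \<forall>j\<in>{0, 1}.
      real (card (H_set m i j \<alpha> \<beta> \<inter> trace_one_set m d :: 'a set)) \<in> {P * P, P * P + P, P * P - P})
    \<longleftrightarrow> (\<forall>i\<in>{0, 1 :: 'a}. \<forall>j\<in>{0, 1 :: 'a}.
      neg_one_pow i * u + neg_one_pow j * v + neg_one_pow i * neg_one_pow j * w \<in> {0, 2, -2})"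
    by (intro ball_cong refl card_value)
  also have "\<dots> \<longleftrightarrow> u + v + w \<in> {0, 2, -2} \<and> u - v - w \<in> {0, 2, -2}
      \<and> - u + v - w \<in> {0, 2, -2} \<and> - u - v + w \<in> {0, 2, -2}"
    by (simp add: neg_one_pow_def del: insert_iff add: ball_simps)
  also have "\<dots> \<longleftrightarrow> (w = 0) = ((u = 0) = (v = 0))"
    using u(2) v(2) w(2) by (elim insertE emptyE) simp_all
  finally show ?thesis unfolding powr1 powr2 u(1) v(1) w(1) by simp
qed

end

theorem theorem1:
  fixes m d :: nat
  assumes "CARD('a::finite_field) = 2 ^ m"
    and "odd m"
    and "maximum_nonlinear m (\<lambda>x::'a. x ^ d)"
  shows "gold_exponent m d \<longleftrightarrow>
    (\<forall>\<alpha> \<beta> :: 'a. \<forall>i\<in>{0, 1}. \<forall>j\<in>{0, 1}. \<alpha> \<noteq> 0 \<and> \<beta> \<noteq> 0 \<and> \<alpha> \<noteq> \<beta> \<longrightarrow>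
      real (card (H_set m i j \<alpha> \<beta> \<inter> trace_one_set m d)) \<in>
        {2 powr (real m - 3),
         2 powr (real m - 3) + 2 powr ((real m - 3) / 2),
         2 powr (real m - 3) - 2 powr ((real m - 3) / 2)})"
    (is "_ \<longleftrightarrow> ?rhs")
proof -
  interpret odd_binary_field "TYPE('a)" m
    by standard (use assms(1,2) in auto)
  show ?thesis
  proof (cases "m = 1")
    case True
    \<comment> \<open>The field has two elements, so the condition on intersections is vacuous,
      while modulo \<open>2 ^ 1 - 1 = 1\<close> every \<open>d\<close> is a Gold exponent.\<close>
    have "\<not> (\<alpha> \<noteq> 0 \<and> \<beta> \<noteq> 0 \<and> \<alpha> \<noteq> \<beta>)" for \<alpha> \<beta> :: 'a
    proof
      assume "\<alpha> \<noteq> 0 \<and> \<beta> \<noteq> 0 \<and> \<alpha> \<noteq> \<beta>"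
      then have "card {0, \<alpha>, \<beta>} = 3" by auto
      then show False using card_mono[of UNIV "{0, \<alpha>, \<beta>}"] assms(1) True by simp
    qed
    moreover have "gold_exponent m d"
      unfolding gold_exponent_def True by (intro exI[of _ 0]) (simp add: cong_def)
    ultimately show ?thesis by blast
  next
    case False
    then obtain p where p: "m = 2 * p + 3"
      using assms(2) by (elim oddE) (auto simp: gr0_conv_Suc dest!: Nat.gr0I)
    note bij = maximum_nonlinear_power_bij[OF assms(3) False]
    have "?rhs \<longleftrightarrow> (\<forall>a b :: 'a. a \<noteq> 0 \<and> b \<noteq> 0 \<and> a \<noteq> b \<longrightarrow>
        (walsh d (a + b) = 0) = ((walsh d a = 0) = (walsh d b = 0)))"
      unfolding ball_simps(3)
      by (intro arg_cong[where f = All] ext imp_cong refl)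
        (rule card_values_iff_walsh_parity[OF assms(3) p]; simp)
    \<comment> \<open>The degenerate cases \<open>a = 0\<close>, \<open>b = 0\<close> and
      \<open>a = b\<close> hold automatically, since the Walsh transform of a permutation vanishes
      at \<open>0\<close>.\<close>
    also have "\<dots> \<longleftrightarrow> (\<forall>a b :: 'a. (walsh d (a + b) = 0) = ((walsh d a = 0) = (walsh d b = 0)))"
    proof (rule iffI, intro allI)
      fix a b :: 'a
      assume *: "\<forall>a b :: 'a. a \<noteq> 0 \<and> b \<noteq> 0 \<and> a \<noteq> b \<longrightarrow>
        (walsh d (a + b) = 0) = ((walsh d a = 0) = (walsh d b = 0))"
      consider "a = 0" | "b = 0" | "a = b" | "a \<noteq> 0 \<and> b \<noteq> 0 \<and> a \<noteq> b" by blast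
      then show "(walsh d (a + b) = 0) = ((walsh d a = 0) = (walsh d b = 0))"
        using * by cases (simp_all add: walsh_0[OF bij(2)])
    qed blast
    also have "\<dots> \<longleftrightarrow> gold_exponent m d"
    proof
      assume "\<forall>a b :: 'a. (walsh d (a + b) = 0) = ((walsh d a = 0) = (walsh d b = 0))"
      then show "gold_exponent m d"
        by (intro trace_derivative_1_imp_gold[OF assms(3) False] walsh_parity_imp_trace_derivative_1) simp
    next
      assume "gold_exponent m d"
      then show "\<forall>a b :: 'a. (walsh d (a + b) = 0) = ((walsh d a = 0) = (walsh d b = 0))"
        using gold_walsh_parity[OF _ False bij(1)] by simp
    qed
    finally show ?thesis by blast
  qed
qed

end
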